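(* Let $a,b>0$ and let $0\leq \nu\leq 1$. Then $$H_{\nu}(a,b)\leq \left(\frac{H_1(a,b)}{H_{1/2}(a,b)}\right)^{1-\nu}F_{\nu}(a,b).$$
   Context: For $a,b> 0$ and $\nu\in[0,1]$, the Heron and Heinz means are, respectively, $$F_{\nu}(a,b)=(1-\nu)\sqrt{ab}+\nu\,\frac{a+b}{2},\qquad H_{\nu}(a,b)=\frac{a^{1-\nu}b^{\nu}+a^{\nu}b^{1-\nu}}{2}.$$ *)

theory Defs
  imports "HOL-Analysis.Analysis"
begin

definition heron_mean :: "real \<Rightarrow> real \<Rightarrow> real \<Rightarrow> real" where
  "heron_mean \<nu> a b = (1 - \<nu>) * sqrt (a * b) + \<nu> * ((a + b) / 2)"

definition heinz_mean :: "real \<Rightarrow> real \<Rightarrow> real \<Rightarrow> real" where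
  "heinz_mean \<nu> a b = (a powr (1 - \<nu>) * b powr \<nu> + a powr \<nu> * b powr (1 - \<nu>)) / 2"

end

theory Submission
  imports Defs
begin

text \<open>
  Write \<open>A\<close> and \<open>G\<close> for the arithmetic and geometric means of \<open>a\<close> and \<open>b\<close>, which are the Heinz
  means at the parameters \<open>1\<close> and \<open>1/2\<close>. The number \<open>A\<close> separates the two sides of the inequality,
  and both halves come from the weighted inequality between the arithmetic and geometric means
  (Young's inequality). Applied to \<open>a\<close> and \<open>b\<close> with both orders of the weights, it bounds every
  Heinz mean by \<open>A\<close>. Applied to \<open>G\<close> and \<open>A\<close>, it bounds the Heron mean, which is the convex
  combination of \<open>G\<close> and \<open>A\<close>, below by \<open>G powr (1 - \<nu>) * A powr \<nu>\<close>; multiplied by the factor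
  \<open>(A / G) powr (1 - \<nu>)\<close>, this lower bound is exactly \<open>A\<close>.
\<close>

lemma heinz_mean_1:
  assumes "0 < a" and "0 < b"
  shows "heinz_mean 1 a b = (a + b) / 2"
  using assms by (simp add: heinz_mean_def)

lemma heinz_mean_half:
  assumes "0 < a" and "0 < b"
  shows "heinz_mean (1/2) a b = sqrt (a * b)"
  using assms by (simp add: heinz_mean_def powr_half_sqrt real_sqrt_mult)

lemma heinz_mean_le_arith_mean:
  assumes "0 < a" and "0 < b" and "0 \<le> \<nu>" and "\<nu> \<le> 1"
  shows "heinz_mean \<nu> a b \<le> (a + b) / 2"
proof -
  have "a powr (1 - \<nu>) * b powr \<nu> \<le> (1 - \<nu>) * a + \<nu> * b"
    using assms by (intro Youngs_inequality_0) auto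
  moreover have "a powr \<nu> * b powr (1 - \<nu>) \<le> \<nu> * a + (1 - \<nu>) * b"
    using assms by (intro Youngs_inequality_0) auto
  ultimately show ?thesis
    by (simp add: heinz_mean_def algebra_simps)
qed

lemma weighted_geo_mean_le_heron_mean:
  assumes "0 < a" and "0 < b" and "0 \<le> \<nu>" and "\<nu> \<le> 1"
  shows "sqrt (a * b) powr (1 - \<nu>) * ((a + b) / 2) powr \<nu> \<le> heron_mean \<nu> a b"
  unfolding heron_mean_def using assms by (intro Youngs_inequality_0) auto

theorem proposition3p4:
  fixes a b \<nu> :: real
  assumes "0 < a" and "0 < b" and "0 \<le> \<nu>" and "\<nu> \<le> 1"
  shows "heinz_mean \<nu> a b
      \<le> (heinz_mean 1 a b / heinz_mean (1/2) a b) powr (1 - \<nu>) * heron_mean \<nu> a b"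
proof -
  define A where "A = (a + b) / 2"
  define G where "G = sqrt (a * b)"
  have pos: "0 < A" "0 < G"
    using assms by (auto simp: A_def G_def)
  have "heinz_mean \<nu> a b \<le> A"
    unfolding A_def using assms by (rule heinz_mean_le_arith_mean)
  also have "A = A powr (1 - \<nu>) * A powr \<nu>"
    using pos by (simp flip: powr_add)
  also have "\<dots> = (A / G) powr (1 - \<nu>) * (G powr (1 - \<nu>) * A powr \<nu>)"
    using pos by (simp add: powr_divide)
  also have "\<dots> \<le> (A / G) powr (1 - \<nu>) * heron_mean \<nu> a b"
    using weighted_geo_mean_le_heron_mean[OF assms]
    by (intro mult_left_mono) (auto simp: A_def G_def)
  finally show ?thesis
    using assms by (simp add: heinz_mean_1 heinz_mean_half A_def G_def)
qed

end
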